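(* Let $F$ be a field with $\mathrm{char}(F)\neq 2$, let $L$ be a Lie algebra over $F$ with derived algebra $L'=[L,L]$, and let $M$ be an $L$-module such that $Z_M(L')=\{0\}$. If $f:L\to M$ is a commuting linear map, then $f\in\mathrm{Cent}(M)$.
   Context: Neither $L$ nor $M$ is assumed finite dimensional. The action of $x\in L$ on $v\in M$ is written $x\cdot v$. A commuting linear map $f:L\to M$ is an $F$-linear map with $x\cdot f(x)=0$ for all $x\in L$. For a subset $S\subseteq L$, $Z_M(S)=\{v\in M : s\cdot v=0 \text{ for all } s\in S\}$. The centroid of $M$, $\mathrm{Cent}(M)$, is the space of all $F$-linear maps $\gamma:L\to M$ with $\gamma([x,y])=x\cdot\gamma(y)$ for all $x,y\in L$. *)

theory Defs
  imports Complex_Main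
begin

locale lie_algebra = vector_space scaleL
  for scaleL :: "'f::field \<Rightarrow> 'l::ab_group_add \<Rightarrow> 'l" +
  fixes bracket :: "'l \<Rightarrow> 'l \<Rightarrow> 'l"
  assumes bracket_linear_right: "Vector_Spaces.linear scaleL scaleL (\<lambda>y. bracket x y)"
    and bracket_linear_left: "Vector_Spaces.linear scaleL scaleL (\<lambda>x. bracket x y)"
    and bracket_self: "bracket x x = 0"
    and jacobi: "bracket x (bracket y z) + bracket y (bracket z x) + bracket z (bracket x y) = 0"

locale lie_module = L: lie_algebra scaleL bracket + M: vector_space scaleM
  for scaleL :: "'f::field \<Rightarrow> 'l::ab_group_add \<Rightarrow> 'l"
    and bracket :: "'l \<Rightarrow> 'l \<Rightarrow> 'l"
    and scaleM :: "'f \<Rightarrow> 'm::ab_group_add \<Rightarrow> 'm" +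
  fixes act :: "'l \<Rightarrow> 'm \<Rightarrow> 'm"
  assumes act_linear_right: "Vector_Spaces.linear scaleM scaleM (\<lambda>v. act x v)"
    and act_linear_left: "Vector_Spaces.linear scaleL scaleM (\<lambda>x. act x v)"
    and act_bracket: "act (bracket x y) v = act x (act y v) - act y (act x v)"

text \<open>The derived algebra \<open>[L, L]\<close> is the linear span of the brackets, not just the set of brackets.\<close>

definition derived_algebra ::
  "('f::field \<Rightarrow> 'l::ab_group_add \<Rightarrow> 'l) \<Rightarrow> ('l \<Rightarrow> 'l \<Rightarrow> 'l) \<Rightarrow> 'l set" where
  "derived_algebra scaleL bracket = module.span scaleL {bracket x y | x y. True}"

definition module_centralizer :: "('l \<Rightarrow> 'm::ab_group_add \<Rightarrow> 'm) \<Rightarrow> 'l set \<Rightarrow> 'm set" where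
  "module_centralizer act S = {v. \<forall>s\<in>S. act s v = 0}"

definition commuting_linear_map ::
  "('f::field \<Rightarrow> 'l::ab_group_add \<Rightarrow> 'l) \<Rightarrow> ('f \<Rightarrow> 'm::ab_group_add \<Rightarrow> 'm)
    \<Rightarrow> ('l \<Rightarrow> 'm \<Rightarrow> 'm) \<Rightarrow> ('l \<Rightarrow> 'm) \<Rightarrow> bool" where
  "commuting_linear_map scaleL scaleM act f \<longleftrightarrow>
     Vector_Spaces.linear scaleL scaleM f \<and> (\<forall>x. act x (f x) = 0)"

definition centroid ::
  "('f::field \<Rightarrow> 'l::ab_group_add \<Rightarrow> 'l) \<Rightarrow> ('l \<Rightarrow> 'l \<Rightarrow> 'l)
    \<Rightarrow> ('f \<Rightarrow> 'm::ab_group_add \<Rightarrow> 'm) \<Rightarrow> ('l \<Rightarrow> 'm \<Rightarrow> 'm) \<Rightarrow> ('l \<Rightarrow> 'm) set" where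
  "centroid scaleL bracket scaleM act =
     {\<gamma>. Vector_Spaces.linear scaleL scaleM \<gamma> \<and> (\<forall>x y. \<gamma> (bracket x y) = act x (\<gamma> y))}"

end

theory Submission
  imports Defs
begin

text \<open>
  Put \<open>D(x, y) = x \<cdot> f y\<close>, which is alternating and a derivation in each argument. Expanding
  \<open>D([x, u], [y, v])\<close> in both possible orders gives a relation between the elements
  \<open>[x, y] \<cdot> D(u, v)\<close> whose symmetries force \<open>[x, y] \<cdot> D(u, v) = - [u, v] \<cdot> D(x, y)\<close>.
  By the Jacobi identity, every \<open>[u, v]\<close> then annihilates the cyclic sum of \<open>D(x, [y, z])\<close>, so
  this sum vanishes. But it equals \<open>2 x \<cdot> (f [y, z] - y \<cdot> f z)\<close>; hence \<open>f [y, z] - y \<cdot> f z\<close> is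
  annihilated by all of \<open>L\<close> and is therefore zero.
\<close>

lemma (in vector_space) add_self_eq_0_iff:
  fixes v :: 'b
  assumes "CHAR('a) \<noteq> 2"
  shows "v + v = 0 \<longleftrightarrow> v = 0"
proof
  assume "v + v = 0"
  have "\<not> CHAR('a) dvd 2"
  proof
    assume "CHAR('a) dvd 2"
    hence "CHAR('a) \<le> 2" "CHAR('a) \<noteq> 0" by (auto intro: dvd_imp_le gr0I)
    thus False using assms CHAR_not_1[where 'a='a] by linarith
  qed
  hence "(2::'a) \<noteq> 0"
    using of_nat_eq_0_iff_char_dvd[where 'a='a and n = 2] by simp
  moreover have "2 *s v = 0"
    using \<open>v + v = 0\<close> scale_left_distrib[of 1 1 v] by simp
  ultimately show "v = 0" by simp
qed simp

context lie_algebra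
begin

lemma bracket_skew: "bracket y x = - bracket x y"
proof -
  have "bracket (x + y) (x + y) = (bracket x x + bracket y x) + (bracket x y + bracket y y)"
    by (simp only: module_hom.add[OF module_hom_linearI[OF bracket_linear_left]]
        module_hom.add[OF module_hom_linearI[OF bracket_linear_right]])
  hence "bracket x y + bracket y x = 0" by (simp add: bracket_self add.commute)
  thus ?thesis by (rule minus_unique[symmetric])
qed

end

context lie_module
begin

lemmas act_add = module_hom.add[OF module_hom_linearI[OF act_linear_right]]
  and act_diff = module_hom.diff[OF module_hom_linearI[OF act_linear_right]]
  and act_minus = module_hom.neg[OF module_hom_linearI[OF act_linear_right]]
  and act_add_left = module_hom.add[OF module_hom_linearI[OF act_linear_left]]
  and act_minus_left = module_hom.neg[OF module_hom_linearI[OF act_linear_left]]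
  and act_zero_left = module_hom.zero[OF module_hom_linearI[OF act_linear_left]]

text \<open>For fixed \<open>v\<close> the elements that kill \<open>v\<close> form a subspace, so
  testing the spanning brackets is enough.\<close>

lemma module_centralizer_derived_algebra:
  assumes "\<And>x y. act (bracket x y) v = 0"
  shows "v \<in> module_centralizer act (derived_algebra scaleL bracket)"
proof -
  have "act s v = 0" if "s \<in> L.span {bracket x y |x y. True}" for s
    using module_hom.eq_0_on_span[OF module_hom_linearI[OF act_linear_left] _ that] assms by blast
  thus ?thesis
    by (simp add: module_centralizer_def derived_algebra_def)
qed

end

locale commuting_map = lie_module scaleL bracket scaleM act
  for scaleL :: "'f::field \<Rightarrow> 'l::ab_group_add \<Rightarrow> 'l"
    and bracket :: "'l \<Rightarrow> 'l \<Rightarrow> 'l"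
    and scaleM :: "'f \<Rightarrow> 'm::ab_group_add \<Rightarrow> 'm"
    and act :: "'l \<Rightarrow> 'm \<Rightarrow> 'm" +
  fixes f :: "'l \<Rightarrow> 'm"
  assumes linear_f: "Vector_Spaces.linear scaleL scaleM f"
    and act_self: "act x (f x) = 0"
    and char_neq_2: "CHAR('f) \<noteq> 2"
begin

definition D :: "'l \<Rightarrow> 'l \<Rightarrow> 'm" where "D x y = act x (f y)"

lemma D_skew: "D y x = - D x y"
proof -
  have "act (x + y) (f (x + y)) = 0" by (rule act_self)
  hence "D x y + D y x = 0"
    by (simp add: module_hom.add[OF module_hom_linearI[OF linear_f]] act_add act_add_left act_self D_def add.commute)
  thus ?thesis by (rule minus_unique[symmetric])
qed

lemma D_bracket_left: "D (bracket x y) z = act x (D y z) - act y (D x z)"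
  by (simp add: D_def act_bracket)

text \<open>How \<open>f\<close> treats brackets is still unknown, so this rule is carried over from
  the left argument by skew-symmetry.\<close>

lemma D_bracket_right: "D z (bracket x y) = act x (D z y) - act y (D z x)"
  using D_bracket_left[of x y z] D_skew[of z] by (simp add: act_minus)

definition S :: "'l \<Rightarrow> 'l \<Rightarrow> 'l \<Rightarrow> 'l \<Rightarrow> 'm" where
  "S x y u v = act (bracket x y) (D u v) + act (bracket u v) (D x y)"

lemma S_swap_12: "S y x u v = - S x y u v"
  using L.bracket_skew[of y x] D_skew[of y x] by (simp add: S_def act_minus act_minus_left)

lemma S_swap_24: "S x y u v = S x v u y"
proof -
  \<comment> \<open>Both sides are \<open>D (bracket x u) (bracket y v)\<close>. Once the inner
    brackets are expanded too, the double actions pair up into commutators: two make up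
    \<open>S x y u v\<close>, two \<open>S x v u y\<close>.\<close>
  have "act x (D u (bracket y v)) - act u (D x (bracket y v))
      = act y (D (bracket x u) v) - act v (D (bracket x u) y)"
    by (simp only: D_bracket_left[symmetric] D_bracket_right[symmetric])
  thus ?thesis
    by (simp add: S_def D_bracket_left D_bracket_right act_bracket act_diff algebra_simps)
qed

text \<open>The swap of arguments 1 and 4 is both (12)(24)(12) and (24)(12)(24). As (12) negates
  \<open>S\<close> and (24) fixes it, the first product fixes \<open>S\<close> and the second
  negates it.\<close>

lemma S_eq_0: "S x y u v = 0"
proof -
  have "S x y u v = - S x y u v"
    by (metis S_swap_12 S_swap_24)
  hence "S x y u v + S x y u v = 0" by (simp add: eq_neg_iff_add_eq_0)
  thus ?thesis by (simp add: M.add_self_eq_0_iff[OF char_neq_2])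
qed

lemma act_bracket_D: "act (bracket u v) (D x y) = - act (bracket x y) (D u v)"
  using S_eq_0[of u v x y] by (simp add: S_def eq_neg_iff_add_eq_0)

lemma D_jacobi:
  assumes "module_centralizer act (derived_algebra scaleL bracket) = {0}"
  shows "D x (bracket y z) + D y (bracket z x) + D z (bracket x y) = 0" (is "?c = 0")
proof -
  have "act (bracket u v) ?c = 0" for u v
  proof -
    \<comment> \<open>Exchanging \<open>bracket u v\<close> with the bracket behind each
      \<open>D\<close> moves the cyclic sum into the acting element, where it is the Jacobi
      sum.\<close>
    have "act (bracket u v) ?c = - act (bracket x (bracket y z) + bracket y (bracket z x)
        + bracket z (bracket x y)) (D u v)"
      by (simp add: act_add act_add_left act_bracket_D[of u v])
    thus ?thesis by (simp add: L.jacobi act_zero_left)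
  qed
  thus ?thesis using module_centralizer_derived_algebra assms by blast
qed

lemma map_bracket:
  assumes Z: "module_centralizer act (derived_algebra scaleL bracket) = {0}"
  shows "f (bracket y z) = act y (f z)"
proof -
  have "act x (f (bracket y z) - D y z) = 0" for x
  proof -
    \<comment> \<open>By the derivation rule and skew-symmetry, the last two terms add up to
      \<open>D x (bracket y z)\<close> minus twice \<open>act x (D y z)\<close>.\<close>
    have "D x (bracket y z) + D y (bracket z x) + D z (bracket x y)
        = (act x (f (bracket y z) - D y z)) + (act x (f (bracket y z) - D y z))"
      using D_bracket_right[of x y z] D_bracket_right[of y z x] D_bracket_right[of z x y]
        D_skew[of x y] D_skew[of y z] D_skew[of z x]
      by (simp add: act_add act_diff act_minus D_def[of x "bracket y z", symmetric])
    thus ?thesis using D_jacobi[OF Z] M.add_self_eq_0_iff[OF char_neq_2] by metis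
  qed
  hence "f (bracket y z) - D y z = 0"
    using module_centralizer_derived_algebra Z by blast
  thus ?thesis by (simp add: D_def)
qed

end

theorem theorem3p2:
  fixes scaleL :: "'f::field \<Rightarrow> 'l::ab_group_add \<Rightarrow> 'l"
    and bracket :: "'l \<Rightarrow> 'l \<Rightarrow> 'l"
    and scaleM :: "'f \<Rightarrow> 'm::ab_group_add \<Rightarrow> 'm"
    and act :: "'l \<Rightarrow> 'm \<Rightarrow> 'm"
    and f :: "'l \<Rightarrow> 'm"
  assumes "CHAR('f) \<noteq> 2"
    and "lie_module scaleL bracket scaleM act"
    and "module_centralizer act (derived_algebra scaleL bracket) = {0}"
    and "commuting_linear_map scaleL scaleM act f"
  shows "f \<in> centroid scaleL bracket scaleM act"
proof -
  interpret commuting_map scaleL bracket scaleM act f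
    using assms(1,2,4)
    by (simp add: commuting_map_def commuting_map_axioms_def commuting_linear_map_def)
  show ?thesis
    using linear_f map_bracket[OF assms(3)] by (simp add: centroid_def)
qed

end
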